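(* Consider the discrete accelerated sticky particle dynamics (see context) with initial mass distribution $\rho_0$ (a probability measure), initial velocity function $u_0$ and non-increasing initial acceleration function $\gamma_0$, and let $\phi,u,\gamma$ be the associated flow, Eulerian velocity and Eulerian acceleration (see context). Let $X_0$ be a real random variable of law $\rho_0$, let $X_t:=\phi(X_0,t)$ and $\rho(\cdot,t)=\mathrm{Law}(X_t)$. Then $(\rho,u\rho,\gamma\rho)$ is a weak solution (see context) of $$\begin{cases}\partial_t(\rho)+\partial_x(u\rho)=0\\ \partial_t(u\rho)+\partial_x(u^2\rho)=\gamma\rho\\ \rho|_{t=0}=\rho_0,\quad u\rho|_{t=0}=u_0\rho_0,\quad\gamma\rho|_{t=0}=\gamma_0\rho_0.\end{cases}$$
   Context: Accelerated sticky particle dynamics. There are $N$ particles with initial positions $x_1<\cdots<x_N$ in $\mathbb{R}$, masses $m_j>0$, initial velocities $v_j\in\mathbb{R}$ and initial accelerations $\theta_j\in\mathbb{R}$. Put $\rho_0=\sum_j m_j\delta_{x_j}$ (here $\sum_jm_j=1$), $u_0(x_j)=v_j$, $\gamma_0(x_j)=\theta_j$. Each particle moves with constant acceleration until it collides; colliding particles stick together, with conservation of mass, momentum and force. Explicitly: for a nonempty set $G\subset\{x_1,\dots,x_N\}$ put $$c_G(t)=\frac{\sum_{x_j\in G}m_j\left(x_j+tv_j+\frac{t^2}{2}\theta_j\right)}{\sum_{x_j\in G}m_j}.$$ At time $0$ the partition $\xi_0$ of $\{x_1,\dots,x_N\}$ consists of the singletons. Let $s_0=0$. Given the partition $\xi_{s_k}$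 at time $s_k$, the next shock time $s_{k+1}$ is the infimum of the times $t>s_k$ at which two distinct elements $G\ne G'$ of $\xi_{s_k}$ satisfy $c_G(t)=c_{G'}(t)$ ($s_{k+1}=+\infty$ if there is none). For $t\in[s_k,s_{k+1})$, $\xi_t=\xi_{s_k}$. At time $s_{k+1}$ all elements of $\xi_{s_k}$ having the same position $c_G(s_{k+1})$ are merged into one, which gives $\xi_{s_{k+1}}$. There are at most $N-1$ shock times. The elements of $\xi_t$ are called the clusters at time $t$. Flow. For $x_i$ in the cluster $G\in\xi_t$, set $$\phi(x_i,t)=c_G(t),\quad v(x_i,t)=\frac{\int_G\left(u_0(\eta)+t\gamma_0(\eta)\right)d\rho_0(\eta)}{\rho_0(G)},\quad \theta(x_i,t)=\frac{\int_G\gamma_0(\eta)\,d\rho_0(\eta)}{\rho_0(G)}.$$ Since distinct clusters at time $t$ have distinct positions, there are functions $u,\gamma$ with $v(x_i,t)=u(\phi(x_i,t),t)$ and $\theta(x_i,t)=\gamma(\phi(x_i,t),t)$. Weak solution. $C^1_0(\mathbb{R})$ is the space of real $C^1$ functions with compact support. A family $(\rho,u\rho,\gamma\rho)$ of fields of Borel measures on $\mathbb{R}$ indexed by $t>0$ is a weak solution of the system if these fields are càdlàg in $t$ for weak convergence of measures, for all $f\in C^1_0(\mathbb{R})$ and all $0<t_1<t_2$ $$\int f\,d\rho(\cdot,t_2)-\int f\,d\rho(\cdot,t_1)=\int_{t_1}^{t_2}\!\!\int f'(x)u(x,t)\,\rho(dx,t)\,dt,$$ $$\int f(x)u(x,t_2)\,\rho(dx,t_2)-\int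 f(x)u(x,t_1)\,\rho(dx,t_1)=\int_{t_1}^{t_2}\!\!\int f'(x)u^2(x,t)\,\rho(dx,t)\,dt+\int_{t_1}^{t_2}\!\!\int f(x)\gamma(x,t)\,\rho(dx,t)\,dt,$$ and for every continuous compactly supported $g$, as $t\to0^+$, $\int g\,d\rho(\cdot,t)\to\int g\,d\rho_0$, $\int g(x)u(x,t)\,\rho(dx,t)\to\int g\,u_0\,d\rho_0$, $\int g(x)\gamma(x,t)\,\rho(dx,t)\to\int g\,\gamma_0\,d\rho_0$. *)

theory Defs
  imports "HOL-Probability.Probability"
begin

section \<open>Accelerated sticky particle dynamics\<close>

text \<open>
  The particles are \<open>x 1 < \<dots> < x N\<close>, with masses \<open>m j\<close>, initial velocities \<open>u\<^sub>0 (x j)\<close> and initial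
  accelerations \<open>\<gamma>\<^sub>0 (x j)\<close>. Only the values of \<open>u\<^sub>0\<close> and \<open>\<gamma>\<^sub>0\<close> at the positions \<open>x j\<close> matter;
  Borel measurability makes integrals against the discrete Borel measure \<open>\<rho>\<^sub>0\<close> meaningful.
\<close>

locale sticky_particles =
  fixes N :: nat and x m :: "nat \<Rightarrow> real" and u\<^sub>0 \<gamma>\<^sub>0 :: "real \<Rightarrow> real"
  assumes positions: "strict_mono_on {1..N} x"
    and mass_pos: "\<And>j. j \<in> {1..N} \<Longrightarrow> m j > 0"
    and total_mass: "(\<Sum>j\<in>{1..N}. m j) = 1"
    and u0_borel: "u\<^sub>0 \<in> borel_measurable borel"
    and \<gamma>0_borel: "\<gamma>\<^sub>0 \<in> borel_measurable borel"
begin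

definition sites :: "real set" where
  "sites = x ` {1..N}"

definition \<rho>\<^sub>0 :: "real measure" where
  "\<rho>\<^sub>0 = distr (point_measure {1..N} (\<lambda>j. ennreal (m j))) borel x"

definition center :: "real set \<Rightarrow> real \<Rightarrow> real" where
  "center G t =
     (\<Sum>j | j \<in> {1..N} \<and> x j \<in> G. m j * (x j + t * u\<^sub>0 (x j) + t\<^sup>2 / 2 * \<gamma>\<^sub>0 (x j)))
     / (\<Sum>j | j \<in> {1..N} \<and> x j \<in> G. m j)"

text \<open>The infimum is taken in the extended reals, so it is \<open>\<infinity>\<close> if no further collision occurs.\<close>

definition next_shock :: "ereal \<Rightarrow> real set set \<Rightarrow> ereal" where
  "next_shock s P =
     Inf {ereal t | t. s < ereal t \<and> (\<exists>G\<in>P. \<exists>G'\<in>P. G \<noteq> G' \<and> center G t = center G' t)}"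

definition merge :: "real \<Rightarrow> real set set \<Rightarrow> real set set" where
  "merge s P = (\<lambda>G. \<Union>{G' \<in> P. center G' s = center G s}) ` P"

text \<open>
  \<open>stage k\<close> is the pair of the \<open>k\<close>-th shock time and the partition at that time. Once the shock
  time is \<open>\<infinity>\<close> the sequence is constant, and its second component is then irrelevant.
\<close>

primrec stage :: "nat \<Rightarrow> ereal \<times> real set set" where
  "stage 0 = (0, (\<lambda>y. {y}) ` sites)"
| "stage (Suc k) =
     (let s' = next_shock (fst (stage k)) (snd (stage k))
      in (s', if s' = \<infinity> then snd (stage k) else merge (real_of_ereal s') (snd (stage k))))"

abbreviation shock :: "nat \<Rightarrow> ereal" where
  "shock k \<equiv> fst (stage k)"

definition clusters :: "real \<Rightarrow> real set set" where
  "clusters t = snd (stage (THE k. shock k \<le> ereal t \<and> ereal t < shock (Suc k)))"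

definition cluster_of :: "real \<Rightarrow> real \<Rightarrow> real set" where
  "cluster_of y t = (THE G. G \<in> clusters t \<and> y \<in> G)"

text \<open>The flow is only meaningful on \<open>sites\<close>, which has full \<open>\<rho>\<^sub>0\<close>-measure.\<close>

definition flow :: "real \<Rightarrow> real \<Rightarrow> real" where
  "flow y t = (if y \<in> sites then center (cluster_of y t) t else 0)"

definition velocity :: "real \<Rightarrow> real \<Rightarrow> real" where
  "velocity y t =
     (LINT \<eta>:cluster_of y t|\<rho>\<^sub>0. u\<^sub>0 \<eta> + t * \<gamma>\<^sub>0 \<eta>) / measure \<rho>\<^sub>0 (cluster_of y t)"

definition acceleration :: "real \<Rightarrow> real \<Rightarrow> real" where
  "acceleration y t = (LINT \<eta>:cluster_of y t|\<rho>\<^sub>0. \<gamma>\<^sub>0 \<eta>) / measure \<rho>\<^sub>0 (cluster_of y t)"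

text \<open>
  \<open>eulerian w W\<close>: the field \<open>w\<close> represents the particle quantity \<open>W\<close> in Eulerian coordinates. This
  determines \<open>w\<close> on the cluster positions, which carry all the mass; elsewhere \<open>w\<close> is an arbitrary
  Borel function. Such a \<open>w\<close> exists for velocity and acceleration, see \<open>eulerian_exists\<close> below.
\<close>

definition eulerian :: "(real \<Rightarrow> real \<Rightarrow> real) \<Rightarrow> (real \<Rightarrow> real \<Rightarrow> real) \<Rightarrow> bool" where
  "eulerian w W \<longleftrightarrow>
     (\<forall>t\<ge>0. (\<lambda>y. w y t) \<in> borel_measurable borel \<and> (\<forall>y\<in>sites. W y t = w (flow y t) t))"

end

section \<open>Weak solutions\<close>

text \<open>
  A finite signed Borel measure is represented as \<open>w \<mu>\<close>, with \<open>\<mu>\<close> a finite Borel measure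
  and \<open>w\<close> a \<open>\<mu>\<close>-integrable density (every finite signed measure is of this form).
\<close>

definition signed_borel :: "real measure \<Rightarrow> (real \<Rightarrow> real) \<Rightarrow> bool" where
  "signed_borel \<mu> w \<longleftrightarrow> sets \<mu> = sets borel \<and> finite_measure \<mu> \<and> integrable \<mu> w"

definition weakly_tends ::
  "(real \<Rightarrow> real measure) \<Rightarrow> (real \<Rightarrow> real \<Rightarrow> real) \<Rightarrow> real measure \<Rightarrow> (real \<Rightarrow> real) \<Rightarrow> real filter \<Rightarrow> bool"
where
  "weakly_tends \<rho> w \<nu> h F \<longleftrightarrow>
     (\<forall>g. continuous_on UNIV g \<and> bounded (range g) \<longrightarrow>
        ((\<lambda>t. LINT y|\<rho> t. g y * w y t) \<longlongrightarrow> (LINT y|\<nu>. g y * h y)) F)"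

definition cadlag_field :: "(real \<Rightarrow> real measure) \<Rightarrow> (real \<Rightarrow> real \<Rightarrow> real) \<Rightarrow> bool" where
  "cadlag_field \<rho> w \<longleftrightarrow>
     (\<forall>t>0. signed_borel (\<rho> t) (\<lambda>y. w y t)
        \<and> weakly_tends \<rho> w (\<rho> t) (\<lambda>y. w y t) (at_right t)
        \<and> (\<exists>\<nu> h. signed_borel \<nu> h \<and> weakly_tends \<rho> w \<nu> h (at_left t)))"

definition compactly_supported :: "(real \<Rightarrow> real) \<Rightarrow> bool" where
  "compactly_supported f \<longleftrightarrow> compact (closure {y. f y \<noteq> 0})"

text \<open>
  Since Isabelle's integrals of non-integrable functions are \<open>0\<close>, integrability of everything
  that is integrated in the two equations is part of the definition.
\<close>

definition weak_solution ::
  "(real \<Rightarrow> real measure) \<Rightarrow> (real \<Rightarrow> real \<Rightarrow> real) \<Rightarrow> (real \<Rightarrow> real \<Rightarrow> real) \<Rightarrow>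
   real measure \<Rightarrow> (real \<Rightarrow> real) \<Rightarrow> (real \<Rightarrow> real) \<Rightarrow> bool"
where
  "weak_solution \<rho> u \<gamma> \<rho>\<^sub>0 u\<^sub>0 \<gamma>\<^sub>0 \<longleftrightarrow>
     cadlag_field \<rho> (\<lambda>y t. 1) \<and> cadlag_field \<rho> u \<and> cadlag_field \<rho> \<gamma> \<and>
     (\<forall>f t1 t2. f C1_differentiable_on UNIV \<and> compactly_supported f \<and> 0 < t1 \<and> t1 < t2 \<longrightarrow>
        (\<forall>t\<in>{t1..t2}. integrable (\<rho> t) (\<lambda>y. deriv f y * (u y t)\<^sup>2)) \<and>
        set_integrable lborel {t1..t2} (\<lambda>t. LINT y|\<rho> t. deriv f y * u y t) \<and>
        set_integrable lborel {t1..t2} (\<lambda>t. LINT y|\<rho> t. deriv f y * (u y t)\<^sup>2) \<and>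
        set_integrable lborel {t1..t2} (\<lambda>t. LINT y|\<rho> t. f y * \<gamma> y t) \<and>
        (LINT y|\<rho> t2. f y) - (LINT y|\<rho> t1. f y)
          = (LINT t:{t1..t2}|lborel. LINT y|\<rho> t. deriv f y * u y t) \<and>
        (LINT y|\<rho> t2. f y * u y t2) - (LINT y|\<rho> t1. f y * u y t1)
          = (LINT t:{t1..t2}|lborel. LINT y|\<rho> t. deriv f y * (u y t)\<^sup>2)
            + (LINT t:{t1..t2}|lborel. LINT y|\<rho> t. f y * \<gamma> y t)) \<and>
     (\<forall>g. continuous_on UNIV g \<and> compactly_supported g \<longrightarrow>
        ((\<lambda>t. LINT y|\<rho> t. g y) \<longlongrightarrow> (LINT y|\<rho>\<^sub>0. g y)) (at_right 0) \<and>
        ((\<lambda>t. LINT y|\<rho> t. g y * u y t) \<longlongrightarrow> (LINT y|\<rho>\<^sub>0. g y * u\<^sub>0 y)) (at_right 0) \<and>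
        ((\<lambda>t. LINT y|\<rho> t. g y * \<gamma> y t) \<longlongrightarrow> (LINT y|\<rho>\<^sub>0. g y * \<gamma>\<^sub>0 y)) (at_right 0))"

section \<open>Existence of the Eulerian fields\<close>

context sticky_particles
begin

abbreviation idx :: "real set \<Rightarrow> nat set" where
  "idx G \<equiv> {j. j \<in> {1..N} \<and> x j \<in> G}"

lemma finite_sites: "finite sites"
  by (simp add: sites_def)

lemma mass_pos_sum:
  assumes "G \<noteq> {}" "G \<subseteq> sites"
  shows "(\<Sum>j\<in>idx G. m j) > 0"
proof -
  have "idx G \<noteq> {}" using assms by (auto simp: sites_def)
  then show ?thesis by (intro sum_pos) (auto intro: mass_pos)
qed

lemma center_quadratic: "\<exists>a b c. \<forall>t. center G t = a + b * t + c * t\<^sup>2"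
proof -
  let ?M = "\<Sum>j\<in>idx G. m j"
  let ?a = "(\<Sum>j\<in>idx G. m j * x j) / ?M"
  let ?b = "(\<Sum>j\<in>idx G. m j * u\<^sub>0 (x j)) / ?M"
  let ?c = "(\<Sum>j\<in>idx G. m j * \<gamma>\<^sub>0 (x j) / 2) / ?M"
  have "center G t = ?a + ?b * t + ?c * t\<^sup>2" for t
  proof -
    have "(\<Sum>j\<in>idx G. m j * (x j + t * u\<^sub>0 (x j) + t\<^sup>2 / 2 * \<gamma>\<^sub>0 (x j)))
      = (\<Sum>j\<in>idx G. m j * x j) + (\<Sum>j\<in>idx G. m j * u\<^sub>0 (x j)) * t
        + (\<Sum>j\<in>idx G. m j * \<gamma>\<^sub>0 (x j) / 2) * t\<^sup>2"
      unfolding sum_distrib_right sum.distrib[symmetric]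
      by (intro sum.cong) (auto simp: algebra_simps)
    then show ?thesis by (simp add: center_def add_divide_distrib)
  qed
  then show ?thesis by blast
qed

lemma finite_meeting_times:
  assumes "center G s \<noteq> center G' s"
  shows "finite {t. center G t = center G' t}"
proof -
  obtain a b c where 1: "\<And>t. center G t = a + b * t + c * t\<^sup>2" using center_quadratic by metis
  obtain a' b' c' where 2: "\<And>t. center G' t = a' + b' * t + c' * t\<^sup>2"
    using center_quadratic by metis
  let ?p = "[:a - a', b - b', c - c':]"
  have eq: "poly ?p t = center G t - center G' t" for t
    by (simp add: 1 2 algebra_simps power2_eq_square)
  have "?p \<noteq> 0" using assms eq[of s] by force
  then have "finite {t. poly ?p t = 0}" by (rule poly_roots_finite)
  then show ?thesis by (simp only: eq right_minus_eq)
qed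

context
  fixes P :: "real set set"
  assumes P: "partition_on sites P"
begin

lemma finite_P: "finite P"
  using P finite_elements finite_sites by blast

lemma block: "G \<in> P \<Longrightarrow> G \<noteq> {} \<and> G \<subseteq> sites"
  using P by (auto simp: partition_on_def)

lemma next_shock_inj:
  assumes inj: "inj_on (\<lambda>G. center G s) P" and t: "s \<le> t" "ereal t < next_shock (ereal s) P"
  shows "inj_on (\<lambda>G. center G t) P"
proof (cases "s = t")
  case False
  show ?thesis
  proof (rule inj_onI, rule ccontr)
    fix G G' assume "G \<in> P" "G' \<in> P" "center G t = center G' t" "G \<noteq> G'"
    then have "next_shock (ereal s) P \<le> ereal t"
      unfolding next_shock_def using False t by (intro Inf_lower) auto
    with t show False by simp
  qed
qed (use inj in simp)

lemma next_shock_attained: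
  assumes inj: "inj_on (\<lambda>G. center G s) P" and fin: "next_shock (ereal s) P \<noteq> \<infinity>"
  obtains t G G' where "next_shock (ereal s) P = ereal t" "s < t" "G \<in> P" "G' \<in> P" "G \<noteq> G'"
    "center G t = center G' t"
proof -
  let ?T = "{t. s < t \<and> (\<exists>G\<in>P. \<exists>G'\<in>P. G \<noteq> G' \<and> center G t = center G' t)}"
  have eq: "next_shock (ereal s) P = Inf (ereal ` ?T)"
    unfolding next_shock_def by (rule arg_cong[where f = Inf]) auto
  have "?T \<subseteq> (\<Union>(G, G')\<in>{(G, G'). G \<in> P \<and> G' \<in> P \<and> G \<noteq> G'}. {t. center G t = center G' t})"
    by auto
  moreover have "finite {(G, G'). G \<in> P \<and> G' \<in> P \<and> G \<noteq> G'}"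
    by (rule finite_subset[of _ "P \<times> P"]) (auto simp: finite_P)
  moreover have "finite {t. center G t = center G' t}" if "G \<in> P" "G' \<in> P" "G \<noteq> G'" for G G'
    using inj that by (intro finite_meeting_times[of _ s]) (auto dest: inj_onD)
  ultimately have fT: "finite ?T" by (elim finite_subset) (auto intro!: finite_UN_I)
  have ne: "?T \<noteq> {}"
  proof
    assume "?T = {}"
    then have "next_shock (ereal s) P = Inf (ereal ` {})" by (simp only: eq)
    with fin show False by (simp add: top_ereal_def)
  qed
  have "Inf (ereal ` ?T) = Min (ereal ` ?T)"
    using fT ne by (intro cInf_eq_Min) auto
  moreover have "Min (ereal ` ?T) \<in> ereal ` ?T" using fT ne by (intro Min_in) auto
  ultimately show ?thesis using that eq by auto
qed

lemma merged_center:
  assumes "G \<in> P"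
  shows "center (\<Union>{G' \<in> P. center G' s = center G s}) s = center G s"
proof -
  let ?Q = "{G' \<in> P. center G' s = center G s}" and ?a = "center G s"
  let ?n = "\<lambda>j. m j * (x j + s * u\<^sub>0 (x j) + s\<^sup>2 / 2 * \<gamma>\<^sub>0 (x j))"
  have split: "sum f (idx (\<Union>?Q)) = (\<Sum>G\<in>?Q. sum f (idx G))" for f :: "nat \<Rightarrow> real"
  proof -
    have "idx (\<Union>?Q) = (\<Union>G\<in>?Q. idx G)" by auto
    moreover have "sum f (\<Union>G\<in>?Q. idx G) = (\<Sum>G\<in>?Q. sum f (idx G))"
      using P finite_P by (intro sum.UNION_disjoint) (auto simp: partition_on_def disjoint_def)
    ultimately show ?thesis by simp
  qed
  have "sum ?n (idx G') = ?a * sum m (idx G')" if "G' \<in> ?Q" for G'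
    using that mass_pos_sum[of G'] block[of G']
    by (auto simp: center_def[of G'] field_simps)
  then have "sum ?n (idx (\<Union>?Q)) = ?a * sum m (idx (\<Union>?Q))"
    unfolding split sum_distrib_left[of ?a "\<lambda>G. sum m (idx G)"] by (intro sum.cong refl)
  moreover have "sum m (idx (\<Union>?Q)) > 0"
    using assms block by (intro mass_pos_sum) auto
  ultimately show ?thesis by (simp add: center_def[of "\<Union>?Q"])
qed

lemma merge_inj: "inj_on (\<lambda>G. center G s) (merge s P)"
proof (rule inj_onI)
  fix H H' assume "H \<in> merge s P" "H' \<in> merge s P" and eq: "center H s = center H' s"
  then obtain G G' where G: "G \<in> P" "H = \<Union>{A \<in> P. center A s = center G s}"
    and G': "G' \<in> P" "H' = \<Union>{A \<in> P. center A s = center G' s}"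
    by (auto simp: merge_def)
  then have "center G s = center G' s" using eq merged_center by simp
  with G G' show "H = H'" by simp
qed

lemma merge_partition: "partition_on sites (merge s P)"
proof (rule partition_onI)
  show "\<Union>(merge s P) = sites"
    using P unfolding merge_def partition_on_def by blast
  show "{} \<notin> merge s P"
    using block by (auto simp: merge_def)
next
  fix H H' assume "H \<in> merge s P" "H' \<in> merge s P" "H \<noteq> H'"
  then obtain G G' where G: "G \<in> P" "H = \<Union>{A \<in> P. center A s = center G s}"
    and G': "G' \<in> P" "H' = \<Union>{A \<in> P. center A s = center G' s}"
    by (auto simp: merge_def)
  have "center G s \<noteq> center G' s" using G G' \<open>H \<noteq> H'\<close> by auto
  moreover have "A \<inter> B = {}" if "A \<in> P" "B \<in> P" "A \<noteq> B" for A B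
    using P that by (auto simp: partition_on_def disjoint_def)
  ultimately have "A \<inter> B = {}" if "A \<in> P" "center A s = center G s" "B \<in> P" "center B s = center G' s"
    for A B using that by metis
  then show "disjnt H H'"
    unfolding disjnt_def G(2) G'(2) by blast
qed

lemma merge_card:
  assumes "G \<in> P" "G' \<in> P" "G \<noteq> G'" "center G s = center G' s"
  shows "card (merge s P) < card P"
proof -
  let ?f = "\<lambda>G. \<Union>{G' \<in> P. center G' s = center G s}"
  have "?f G = ?f G'" using assms(4) by simp
  then have "\<not> inj_on ?f P" using assms(1-3) by (meson inj_onD)
  then have "card (?f ` P) \<noteq> card P" using eq_card_imp_inj_on[OF finite_P] by blast
  moreover have "card (?f ` P) \<le> card P" using finite_P by (rule card_image_le)
  ultimately show ?thesis unfolding merge_def by (rule le_neq_implies_less[rotated])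
qed

end

lemma stage_invariant:
  "partition_on sites (snd (stage k)) \<and> 0 \<le> shock k \<and>
   (shock k \<noteq> \<infinity> \<longrightarrow> inj_on (\<lambda>G. center G (real_of_ereal (shock k))) (snd (stage k))
      \<and> card (snd (stage k)) + k \<le> N)"
proof (induction k)
  case 0
  have "center {y} 0 = y" if "y \<in> sites" for y
  proof -
    obtain i where i: "i \<in> {1..N}" "y = x i" using \<open>y \<in> sites\<close> by (auto simp: sites_def)
    have "idx {y} = {i}"
      using i strict_mono_on_imp_inj_on[OF positions] by (auto dest: inj_onD)
    then show ?thesis using i mass_pos[of i] by (simp add: center_def)
  qed
  then have "inj_on (\<lambda>G. center G 0) ((\<lambda>y. {y}) ` sites)"
    by (auto simp: inj_on_def)
  moreover have "card ((\<lambda>y. {y}) ` sites) \<le> N"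
    by (metis card_image_le card_atLeastAtMost diff_Suc_1 finite_atLeastAtMost finite_sites
        le_trans sites_def)
  moreover have "partition_on sites ((\<lambda>y. {y}) ` sites)"
    by (auto simp: partition_on_def disjoint_def)
  ultimately show ?case by simp
next
  case (Suc k)
  let ?P = "snd (stage k)" and ?s = "next_shock (shock k) (snd (stage k))"
  have P: "partition_on sites ?P" and pos: "0 \<le> shock k" using Suc by auto
  show ?case
  proof (cases "?s = \<infinity>")
    case True
    then show ?thesis using P by (simp add: Let_def)
  next
    case False
    have nt: "shock k \<noteq> \<infinity>"
    proof
      assume "shock k = \<infinity>"
      then have "?s = \<infinity>" by (simp add: next_shock_def top_ereal_def)
      with False show False by simp
    qed
    then obtain s where s: "shock k = ereal s" using pos by (cases "shock k") auto
    have inj: "inj_on (\<lambda>G. center G s) ?P" and card: "card ?P + k \<le> N" using Suc nt s by auto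
    obtain t G G' where *: "?s = ereal t" "s < t" "G \<in> ?P" "G' \<in> ?P" "G \<noteq> G'"
        "center G t = center G' t"
      using next_shock_attained[OF P inj] False s by metis
    have "card (merge t ?P) < card ?P" using merge_card[OF P] * by blast
    then show ?thesis
      using * merge_inj[OF P, of t] merge_partition[OF P, of t] card pos s
      by (auto simp: Let_def)
  qed
qed

lemma shock_mono: "k \<le> l \<Longrightarrow> shock k \<le> shock l"
proof (induction rule: dec_induct)
  case (step l)
  have "shock l \<le> shock (Suc l)"
    by (auto simp: Let_def next_shock_def intro!: Inf_greatest)
  with step show ?case by simp
qed simp

lemma current_stage:
  assumes "t \<ge> 0"
  shows "\<exists>!k. shock k \<le> ereal t \<and> ereal t < shock (Suc k)"
proof (rule ex_ex1I)
  have bd: "k \<le> N" if "shock k \<le> ereal t" for k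
    using stage_invariant[of k] that by auto
  define k where "k = Max {k. shock k \<le> ereal t}"
  have fin: "finite {k. shock k \<le> ereal t}"
    by (rule finite_subset[of _ "{..N}"]) (use bd in auto)
  have "k \<in> {k. shock k \<le> ereal t}"
    unfolding k_def using assms by (intro Max_in fin) (auto intro!: exI[of _ 0])
  moreover have "Suc k \<notin> {k. shock k \<le> ereal t}"
    using Max_ge[OF fin, of "Suc k"] by (auto simp: k_def simp del: stage.simps)
  ultimately show "\<exists>k. shock k \<le> ereal t \<and> ereal t < shock (Suc k)"
    by (metis mem_Collect_eq not_le)
next
  fix k l
  assume "shock k \<le> ereal t \<and> ereal t < shock (Suc k)" "shock l \<le> ereal t \<and> ereal t < shock (Suc l)"
  then show "k = l"
    using shock_mono[of "Suc k" l] shock_mono[of "Suc l" k]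
    by (metis Suc_leI leD le_less_trans linorder_neqE_nat)
qed

lemma clusters_partition:
  assumes "t \<ge> 0"
  shows "partition_on sites (clusters t)" "inj_on (\<lambda>G. center G t) (clusters t)"
proof -
  obtain k where k: "shock k \<le> ereal t" "ereal t < shock (Suc k)"
    using current_stage[OF assms] by blast
  have cl: "clusters t = snd (stage k)"
    unfolding clusters_def using k current_stage[OF assms]
    by (intro arg_cong[where f = "\<lambda>k. snd (stage k)"] the1_equality) auto
  have inv: "partition_on sites (snd (stage k))" "0 \<le> shock k"
    using stage_invariant by auto
  then obtain s where s: "shock k = ereal s" using k by (cases "shock k") auto
  have "inj_on (\<lambda>G. center G s) (snd (stage k))" using stage_invariant[of k] s by simp
  then have "inj_on (\<lambda>G. center G t) (snd (stage k))"
    using next_shock_inj[OF inv(1), of s t] k s by (simp add: Let_def)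
  with inv(1) cl show "partition_on sites (clusters t)" "inj_on (\<lambda>G. center G t) (clusters t)"
    by simp_all
qed

lemma cluster_of:
  assumes "t \<ge> 0" "y \<in> sites"
  shows "cluster_of y t \<in> clusters t" "y \<in> cluster_of y t"
proof -
  have p: "\<Union>(clusters t) = sites" "disjoint (clusters t)"
    using clusters_partition(1)[OF assms(1)] by (auto simp: partition_on_def)
  have "\<exists>!G. G \<in> clusters t \<and> y \<in> G"
  proof (rule ex_ex1I)
    show "\<exists>G. G \<in> clusters t \<and> y \<in> G" using p(1) assms(2) by auto
    show "G = G'" if "G \<in> clusters t \<and> y \<in> G" "G' \<in> clusters t \<and> y \<in> G'" for G G'
      using disjointD[OF p(2), of G G'] that by auto
  qed
  from theI'[OF this] show "cluster_of y t \<in> clusters t" "y \<in> cluster_of y t"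
    by (auto simp: cluster_of_def)
qed

lemma flow_eq_cluster_eq:
  assumes "t \<ge> 0" "y \<in> sites" "z \<in> sites" "flow y t = flow z t"
  shows "cluster_of y t = cluster_of z t"
  using clusters_partition(2)[OF assms(1)] cluster_of[OF assms(1)] assms(2-4)
  by (auto simp: flow_def dest: inj_onD)

lemma eulerian_exists:
  shows "\<exists>u. eulerian u velocity" and "\<exists>\<gamma>. eulerian \<gamma> acceleration"
proof -
  have *: "\<exists>w. eulerian w W"
    if W: "\<And>y z t. cluster_of y t = cluster_of z t \<Longrightarrow> W y t = W z t" for W
  proof -
    define w where "w = (\<lambda>a t. \<Sum>b\<in>(\<lambda>z. flow z t) ` sites.
      W (SOME z. z \<in> sites \<and> flow z t = b) t * indicator {b} a)"
    have "(\<lambda>y. w y t) \<in> borel_measurable borel" for t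
      unfolding w_def by measurable
    moreover have "W y t = w (flow y t) t" if "t \<ge> 0" "y \<in> sites" for y t
    proof -
      let ?z = "SOME z. z \<in> sites \<and> flow z t = flow y t"
      have z: "?z \<in> sites \<and> flow ?z t = flow y t" by (rule someI[of _ y]) (use that in simp)
      have "w (flow y t) t = (\<Sum>b\<in>(\<lambda>z. flow z t) ` sites. if b = flow y t then W ?z t else 0)"
        unfolding w_def by (intro sum.cong) (auto simp: indicator_def)
      also have "\<dots> = W ?z t" using that finite_sites by simp
      also have "\<dots> = W y t" using flow_eq_cluster_eq z that by (intro W) blast
      finally show ?thesis by simp
    qed
    ultimately show ?thesis unfolding eulerian_def by blast
  qed
  show "\<exists>u. eulerian u velocity" "\<exists>\<gamma>. eulerian \<gamma> acceleration"
    by (rule *; simp add: velocity_def acceleration_def)+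
qed

end

end

theory Submission
  imports Defs
begin

text \<open>
  \<open>velocity\<close> and \<open>acceleration\<close> are cluster means of the free data \<open>u\<^sub>0 (x j) + t * \<gamma>\<^sub>0 (x j)\<close> and
  \<open>\<gamma>\<^sub>0 (x j)\<close>. A function of the position is constant on clusters, so integrating it against \<open>u \<rho>\<close> or
  \<open>\<gamma> \<rho>\<close> gives \<open>\<Sum>j. m j * g (flow (x j) t) * w j t\<close> with the free data as \<open>w j t\<close>. As trajectories
  are continuous, so are the three fields. Trajectories are quadratic between consecutive shocks,
  with derivative \<open>velocity\<close>, so both equations are instances of the fundamental theorem of
  calculus with finitely many exceptional times.
\<close>

section \<open>A fundamental theorem of calculus with exceptional points\<close>

text \<open>The gauge-integral form of the theorem tolerates finitely many points without a
  derivative as long as \<open>F\<close> is continuous. Lebesgue integrability of \<open>f\<close>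
  then identifies the two integrals.\<close>

lemma set_integral_FTC_finite_exceptions:
  fixes F f :: "real \<Rightarrow> real"
  assumes "finite S" "a \<le> b" "continuous_on {a..b} F"
    and "\<And>t. t \<in> {a<..<b} - S \<Longrightarrow> (F has_real_derivative f t) (at t)"
    and "set_integrable lborel {a..b} f"
  shows "(LINT t:{a..b}|lborel. f t) = F b - F a"
proof -
  have "(f has_integral (F b - F a)) {a..b}"
    using assms by (intro fundamental_theorem_of_calculus_interior_strong[of S])
      (auto simp: has_real_derivative_iff_has_vector_derivative)
  then show ?thesis
    using set_borel_integral_eq_integral(2)[OF assms(5)] integral_unique by metis
qed

context sticky_particles
begin

text \<open>From here on \<open>shock (Suc k)\<close> is treated as an opaque time; the recursion is
  unfolded only where the merging itself matters.\<close>

declare stage.simps(2) [simp del]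

section \<open>Integrals against the initial measure as finite sums\<close>

lemma x_in_sites: "j \<in> {1..N} \<Longrightarrow> x j \<in> sites"
  by (simp add: sites_def)

lemma mass_nonneg: "j \<in> {1..N} \<Longrightarrow> 0 \<le> m j"
  using mass_pos less_imp_le by blast

lemma integral_\<rho>\<^sub>0:
  fixes F :: "real \<Rightarrow> real"
  assumes "F \<in> borel_measurable borel"
  shows "(LINT y|\<rho>\<^sub>0. F y) = (\<Sum>j\<in>{1..N}. m j * F (x j))"
proof -
  have "(LINT y|\<rho>\<^sub>0. F y) = (LINT j|point_measure {1..N} (\<lambda>j. ennreal (m j)). F (x j))"
    unfolding \<rho>\<^sub>0_def using assms by (intro integral_distr) (auto simp: point_measure_def)
  also have "\<dots> = (\<Sum>j\<in>{1..N}. m j * F (x j))"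
    by (subst lebesgue_integral_point_measure_finite) (auto simp: mass_nonneg)
  finally show ?thesis .
qed

lemma measurable_\<rho>\<^sub>0: "measurable \<rho>\<^sub>0 M = measurable borel M"
  by (intro measurable_cong_sets) (auto simp: \<rho>\<^sub>0_def)

lemma prob_space_\<rho>\<^sub>0: "prob_space \<rho>\<^sub>0"
proof -
  have "emeasure (point_measure {1..N} (\<lambda>j. ennreal (m j))) {1..N} = (\<Sum>j\<in>{1..N}. ennreal (m j))"
    by (rule emeasure_point_measure_finite) auto
  also have "\<dots> = ennreal (\<Sum>j\<in>{1..N}. m j)"
    by (intro sum_ennreal) (auto simp: mass_nonneg)
  also have "\<dots> = 1"
    using total_mass by simp
  finally have "prob_space (point_measure {1..N} (\<lambda>j. ennreal (m j)))"
    by (intro prob_spaceI) (simp add: space_point_measure)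
  then show ?thesis
    unfolding \<rho>\<^sub>0_def by (rule prob_space.prob_space_distr) (simp add: point_measure_def)
qed

lemma measure_\<rho>\<^sub>0:
  assumes "G \<in> sets borel"
  shows "measure \<rho>\<^sub>0 G = (\<Sum>j\<in>idx G. m j)"
proof -
  have "measure \<rho>\<^sub>0 G = (LINT y|\<rho>\<^sub>0. indicator G y)"
    by (simp add: \<rho>\<^sub>0_def)
  also have "\<dots> = (\<Sum>j\<in>{1..N}. m j * indicator G (x j))"
    using assms by (intro integral_\<rho>\<^sub>0) auto
  also have "\<dots> = (\<Sum>j\<in>idx G. m j)"
    by (intro sum.mono_neutral_cong_right) (auto simp: indicator_def)
  finally show ?thesis .
qed

lemma set_integral_\<rho>\<^sub>0:
  fixes F :: "real \<Rightarrow> real"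
  assumes "G \<in> sets borel" "F \<in> borel_measurable borel"
  shows "(LINT y:G|\<rho>\<^sub>0. F y) = (\<Sum>j\<in>idx G. m j * F (x j))"
proof -
  have "(LINT y:G|\<rho>\<^sub>0. F y) = (\<Sum>j\<in>{1..N}. m j * (indicator G (x j) *\<^sub>R F (x j)))"
    unfolding set_lebesgue_integral_def using assms by (intro integral_\<rho>\<^sub>0) auto
  also have "\<dots> = (\<Sum>j\<in>idx G. m j * F (x j))"
    by (intro sum.mono_neutral_cong_right) (auto simp: indicator_def)
  finally show ?thesis .
qed

section \<open>Clusters and averages over them\<close>

lemma clusters_subset_sites: "t \<ge> 0 \<Longrightarrow> G \<in> clusters t \<Longrightarrow> G \<noteq> {} \<and> G \<subseteq> sites"
  using block clusters_partition(1) by blast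

lemma cluster_borel: "t \<ge> 0 \<Longrightarrow> G \<in> clusters t \<Longrightarrow> G \<in> sets borel"
  using clusters_subset_sites finite_subset[OF _ finite_sites]
  by (metis borel_closed finite_imp_closed)

lemma cluster_of_eq:
  assumes "t \<ge> 0" "G \<in> clusters t" "y \<in> G"
  shows "cluster_of y t = G"
proof -
  have "y \<in> sites" using assms clusters_subset_sites by blast
  then show ?thesis
    using cluster_of[of t y] assms clusters_partition(1)[of t]
    by (auto simp: partition_on_def disjoint_def)
qed

text \<open>For a cluster \<open>G\<close> this is the conditional mean of \<open>a\<close> given
  \<open>G\<close> under \<open>\<rho>\<^sub>0\<close>. The finite sums make its dependence on time
  explicit when \<open>a\<close> depends on time.\<close>

definition cluster_mean :: "(real \<Rightarrow> real) \<Rightarrow> real set \<Rightarrow> real" where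
  "cluster_mean a G = (\<Sum>j\<in>idx G. m j * a (x j)) / (\<Sum>j\<in>idx G. m j)"

lemma velocity_eq_mean:
  assumes "t \<ge> 0" "y \<in> sites"
  shows "velocity y t = cluster_mean (\<lambda>\<eta>. u\<^sub>0 \<eta> + t * \<gamma>\<^sub>0 \<eta>) (cluster_of y t)"
  using cluster_borel[OF assms(1) cluster_of(1)[OF assms]] u0_borel \<gamma>0_borel
  by (simp add: velocity_def cluster_mean_def measure_\<rho>\<^sub>0 set_integral_\<rho>\<^sub>0)

lemma acceleration_eq_mean:
  assumes "t \<ge> 0" "y \<in> sites"
  shows "acceleration y t = cluster_mean \<gamma>\<^sub>0 (cluster_of y t)"
  using cluster_borel[OF assms(1) cluster_of(1)[OF assms]] \<gamma>0_borel
  by (simp add: acceleration_def cluster_mean_def measure_\<rho>\<^sub>0 set_integral_\<rho>\<^sub>0)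

text \<open>This is the tower property of conditional expectation: a factor \<open>h\<close> that is
  constant on clusters can be pulled out of the mean, and mass times mean returns the sum of
  \<open>a\<close> over the cluster.\<close>

lemma sum_cluster_mean:
  assumes t: "t \<ge> 0"
    and h: "\<And>y z. y \<in> sites \<Longrightarrow> z \<in> sites \<Longrightarrow> cluster_of y t = cluster_of z t \<Longrightarrow> h y = h z"
  shows "(\<Sum>j\<in>{1..N}. m j * (h (x j) * cluster_mean a (cluster_of (x j) t)))
    = (\<Sum>j\<in>{1..N}. m j * (h (x j) * a (x j)))"
proof -
  have part: "partition_on sites (clusters t)" using clusters_partition t by blast
  \<comment> \<open>The index sets of the clusters partition \<open>{1..N}\<close>, so it suffices
    to compare the sums cluster by cluster.\<close>
  have split: "sum f {1..N} = (\<Sum>G\<in>clusters t. sum f (idx G))" for f :: "nat \<Rightarrow> real"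
  proof -
    have "{1..N} = (\<Union>G\<in>clusters t. idx G)"
      using x_in_sites partition_onD1[OF part] by blast
    then have "sum f {1..N} = sum f (\<Union>G\<in>clusters t. idx G)" by (rule arg_cong)
    also have "sum f (\<Union>G\<in>clusters t. idx G) = (\<Sum>G\<in>clusters t. sum f (idx G))"
      using part finite_P[OF part]
      by (intro sum.UNION_disjoint) (auto simp: partition_on_def disjoint_def)
    finally show ?thesis .
  qed
  have "(\<Sum>j\<in>idx G. m j * (h (x j) * cluster_mean a (cluster_of (x j) t)))
      = (\<Sum>j\<in>idx G. m j * (h (x j) * a (x j)))" if G: "G \<in> clusters t" for G
  proof -
    have ne: "G \<noteq> {}" "G \<subseteq> sites" using clusters_subset_sites t G by auto
    then obtain z where z: "z \<in> G" by blast
    have hz: "h (x j) = h z" if "j \<in> idx G" for j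
      using that ne z G t by (intro h) (auto simp: cluster_of_eq)
    have "(\<Sum>j\<in>idx G. m j * (h (x j) * cluster_mean a (cluster_of (x j) t)))
        = (\<Sum>j\<in>idx G. m j * (h z * cluster_mean a G))"
      using G t by (intro sum.cong) (auto simp: cluster_of_eq hz)
    also have "\<dots> = h z * ((\<Sum>j\<in>idx G. m j) * cluster_mean a G)"
      unfolding sum_distrib_right sum_distrib_left by (simp add: ac_simps)
    \<comment> \<open>The mass of a nonempty cluster is positive, so the denominator of the mean
      cancels.\<close>
    also have "(\<Sum>j\<in>idx G. m j) * cluster_mean a G = (\<Sum>j\<in>idx G. m j * a (x j))"
      using mass_pos_sum[OF ne] by (simp add: cluster_mean_def)
    also have "h z * \<dots> = (\<Sum>j\<in>idx G. m j * (h (x j) * a (x j)))"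
      unfolding sum_distrib_left by (intro sum.cong) (auto simp: hz)
    finally show ?thesis .
  qed
  then show ?thesis unfolding split by (rule sum.cong[OF refl])
qed

section \<open>Trajectories\<close>

lemma center_has_derivative:
  "(center G has_real_derivative cluster_mean (\<lambda>\<eta>. u\<^sub>0 \<eta> + t * \<gamma>\<^sub>0 \<eta>) G) (at t)"
proof -
  have "((\<lambda>t. (\<Sum>j\<in>idx G. m j * (x j + t * u\<^sub>0 (x j) + t\<^sup>2 / 2 * \<gamma>\<^sub>0 (x j))) / (\<Sum>j\<in>idx G. m j))
    has_real_derivative (\<Sum>j\<in>idx G. m j * (u\<^sub>0 (x j) + t * \<gamma>\<^sub>0 (x j))) / (\<Sum>j\<in>idx G. m j)) (at t)"
    by (intro DERIV_cdivide DERIV_sum) (auto intro!: derivative_eq_intros)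
  then show ?thesis by (simp add: center_def[abs_def] cluster_mean_def)
qed

lemma continuous_on_center: "continuous_on A (center G)"
  using center_has_derivative DERIV_isCont by (intro continuous_at_imp_continuous_on) blast

lemma shock_nonneg: "shock k \<le> ereal t \<Longrightarrow> t \<ge> 0"
  using stage_invariant[of k] order_trans[of 0 "shock k" "ereal t"] by simp

lemma clusters_stage:
  assumes "shock k \<le> ereal t" "ereal t < shock (Suc k)"
  shows "clusters t = snd (stage k)"
  unfolding clusters_def using assms current_stage[OF shock_nonneg]
  by (intro arg_cong[where f = "\<lambda>k. snd (stage k)"] the1_equality) auto

text \<open>Cluster positions are distinct at a shock time and two of them meet only finitely often
  afterwards. The infimum defining the next shock is therefore attained at a strictly later time, or
  is infinite.\<close>

lemma shock_less: "shock k \<noteq> \<infinity> \<Longrightarrow> shock k < shock (Suc k)"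
proof -
  assume k: "shock k \<noteq> \<infinity>"
  then obtain s where s: "shock k = ereal s"
    using stage_invariant[of k] by (cases "shock k") auto
  show ?thesis
  proof (cases "next_shock (ereal s) (snd (stage k)) = \<infinity>")
    case False
    have "partition_on sites (snd (stage k))" "inj_on (\<lambda>G. center G s) (snd (stage k))"
      using stage_invariant[of k] s by auto
    from next_shock_attained[OF this False]
    obtain t where "next_shock (ereal s) (snd (stage k)) = ereal t" "s < t"
      by metis
    then show ?thesis by (simp add: s stage.simps(2) Let_def)
  qed (simp add: s stage.simps(2) Let_def)
qed

text \<open>Every finite shock removes at least one cluster, and there are at most \<open>N\<close>
  initially. Hence the stages up to \<open>N\<close> cover all times, which makes the later
  decompositions of time finite.\<close>

lemma stage_bound: "shock k \<le> ereal t \<Longrightarrow> k \<le> N"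
  using stage_invariant[of k] by auto

text \<open>The formula for the flow extends to the closed right end of the stage, although the
  cluster may have changed there: merging clusters at a common position keeps that position as the
  center. This overlap is what makes trajectories continuous.\<close>

lemma stage_trajectory:
  assumes y: "y \<in> sites"
  shows "\<exists>G. (\<forall>t. shock k \<le> ereal t \<and> ereal t < shock (Suc k) \<longrightarrow> cluster_of y t = G) \<and>
    (\<forall>t. shock k \<le> ereal t \<and> ereal t \<le> shock (Suc k) \<longrightarrow> flow y t = center G t)"
proof -
  have part: "partition_on sites (snd (stage k))" using stage_invariant by blast
  then obtain G where G: "G \<in> snd (stage k)" "y \<in> G" using y by (auto simp: partition_on_def)
  show ?thesis
  proof (intro exI[of _ G] conjI allI impI; elim conjE)
    show 1: "cluster_of y t = G" if "shock k \<le> ereal t" "ereal t < shock (Suc k)" for t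
      using that G shock_nonneg by (intro cluster_of_eq) (auto simp: clusters_stage)
    show "flow y t = center G t" if t: "shock k \<le> ereal t" "ereal t \<le> shock (Suc k)" for t
    proof (cases "ereal t = shock (Suc k)")
      case False
      then show ?thesis using 1 t y by (simp add: flow_def)
    next
      case True
      let ?H = "\<Union>{G' \<in> snd (stage k). center G' t = center G t}"
      \<comment> \<open>The shock after this one is strictly later, so \<open>t\<close> itself
        already belongs to stage \<open>Suc k\<close> and its clusters are the merged ones.\<close>
      have "ereal t < shock (Suc (Suc k))" using shock_less[of "Suc k"] True by (metis PInfty_neq_ereal(1))
      then have "clusters t = snd (stage (Suc k))" using True by (intro clusters_stage) auto
      also have "\<dots> = merge t (snd (stage k))" using True[symmetric] by (auto simp: stage.simps(2) Let_def)
      finally have "?H \<in> clusters t" using G by (auto simp: merge_def)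
      moreover have "y \<in> ?H" using G by blast
      ultimately have "cluster_of y t = ?H" using shock_nonneg t by (intro cluster_of_eq)
      then show ?thesis using merged_center[OF part G(1)] y by (simp add: flow_def)
    qed
  qed
qed

text \<open>Pasting argument: finitely many closed time intervals cover the half-line, and on each
  of them the flow is the center of one fixed set, a quadratic polynomial in time.\<close>

lemma continuous_on_flow:
  assumes "y \<in> sites"
  shows "continuous_on {0..} (flow y)"
proof -
  let ?I = "\<lambda>k. {t. shock k \<le> ereal t \<and> ereal t \<le> shock (Suc k)}"
  have "continuous_on (\<Union>k\<in>{..N}. ?I k) (flow y)"
  proof (rule continuous_on_closed_Union)
    show "closed (?I k)" for k
      by (intro closed_Collect_conj closed_Collect_le continuous_intros)
    show "continuous_on (?I k) (flow y)" for k
    proof -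
      obtain G where "\<forall>t. shock k \<le> ereal t \<and> ereal t \<le> shock (Suc k) \<longrightarrow> flow y t = center G t"
        using stage_trajectory[OF assms, of k] by blast
      then have "continuous_on (?I k) (flow y) \<longleftrightarrow> continuous_on (?I k) (center G)"
        by (intro continuous_on_cong refl) blast
      then show ?thesis using continuous_on_center by simp
    qed
  qed simp
  moreover have "{0..} \<subseteq> (\<Union>k\<in>{..N}. ?I k)"
  proof
    fix t :: real assume "t \<in> {0..}"
    then obtain k where "shock k \<le> ereal t" "ereal t < shock (Suc k)" using current_stage[of t] by auto
    then show "t \<in> (\<Union>k\<in>{..N}. ?I k)" using stage_bound[of k t] by auto
  qed
  ultimately show ?thesis by (rule continuous_on_subset)
qed

lemma flow_initial:
  assumes "y \<in> sites"
  shows "flow y 0 = y"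
proof -
  \<comment> \<open>The first shock is strictly positive, so time 0 lies in stage 0, whose clusters
    are singletons.\<close>
  have "shock 0 < shock (Suc 0)" by (rule shock_less) simp
  then have "clusters 0 = (\<lambda>y. {y}) ` sites"
    using clusters_stage[of 0 0] by (simp add: zero_ereal_def)
  then have *: "cluster_of y 0 = {y}" using assms by (intro cluster_of_eq) auto
  obtain i where i: "i \<in> {1..N}" "y = x i" using assms by (auto simp: sites_def)
  have "idx {y} = {i}"
    using i strict_mono_on_imp_inj_on[OF positions] by (auto dest: inj_onD)
  then have "center {y} 0 = y" using i mass_pos[of i] by (simp add: center_def)
  then show ?thesis using assms * by (simp add: flow_def)
qed

section \<open>Differentiability and integrability in time\<close>

text \<open>Only finite shocks count, and 0 is among them as \<open>shock 0\<close>. This is the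
  exceptional set for the fundamental theorem of calculus.\<close>

definition shock_times :: "real set" where
  "shock_times = {t. \<exists>k. shock k = ereal t}"

lemma finite_shock_times: "finite shock_times"
proof -
  have "shock_times \<subseteq> (\<lambda>k. real_of_ereal (shock k)) ` {..N}"
  proof
    fix t assume "t \<in> shock_times"
    then obtain k where k: "shock k = ereal t" by (auto simp: shock_times_def)
    then have "k \<le> N" by (intro stage_bound[of k t]) simp
    with k show "t \<in> (\<lambda>k. real_of_ereal (shock k)) ` {..N}" by (intro image_eqI[of _ _ k]) auto
  qed
  then show ?thesis by (rule finite_subset) simp
qed

text \<open>Off the shock times, \<open>t\<close> is interior to its stage, so near \<open>t\<close>
  the trajectory coincides with the center of one fixed cluster, whose derivative is the mean free
  velocity.\<close>

lemma flow_has_derivative: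
  assumes y: "y \<in> sites" and t: "0 \<le> t" "t \<notin> shock_times"
  shows "(flow y has_real_derivative velocity y t) (at t)"
proof -
  obtain k where k: "shock k \<le> ereal t" "ereal t < shock (Suc k)" using current_stage[of t] t by auto
  obtain G where G: "cluster_of y t = G"
    "\<forall>t. shock k \<le> ereal t \<and> ereal t \<le> shock (Suc k) \<longrightarrow> flow y t = center G t"
    using stage_trajectory[OF y, of k] k by blast
  have "shock k \<noteq> ereal t" using t by (auto simp: shock_times_def)
  with k have mem: "t \<in> {t. shock k < ereal t \<and> ereal t < shock (Suc k)}" (is "_ \<in> ?U") by auto
  have "open ?U" by (intro open_Collect_conj open_Collect_less continuous_intros)
  then have "(flow y has_real_derivative cluster_mean (\<lambda>\<eta>. u\<^sub>0 \<eta> + t * \<gamma>\<^sub>0 \<eta>) G) (at t)"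
    using mem G(2)
    by (intro has_field_derivative_transform_within_open[OF center_has_derivative, where S = ?U])
      (auto simp: less_imp_le)
  then show ?thesis using velocity_eq_mean G(1) y t by simp
qed

text \<open>Serves functions that may jump at shocks: agreement with a continuous function on each
  half-open stage suffices, since finitely many stages cover \<open>{a..b}\<close>.\<close>

lemma set_integrable_stagewise:
  fixes h :: "real \<Rightarrow> real"
  assumes a: "0 \<le> a"
    and h: "\<And>k. \<exists>F. continuous_on UNIV F \<and>
      (\<forall>t. shock k \<le> ereal t \<longrightarrow> ereal t < shock (Suc k) \<longrightarrow> h t = F t)"
  shows "set_integrable lborel {a..b} h"
proof -
  let ?A = "\<lambda>k. {a..b} \<inter> {t. shock k \<le> ereal t \<and> ereal t < shock (Suc k)}"
  have meas: "?A k \<in> sets lborel" for k by simp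
  have "set_integrable lborel (\<Union>k\<in>{..N}. ?A k) h"
  proof (rule set_integrable_UN)
    show "set_integrable lborel (?A k) h" for k
    proof -
      obtain F where F: "continuous_on UNIV F"
        "\<And>t. shock k \<le> ereal t \<Longrightarrow> ereal t < shock (Suc k) \<Longrightarrow> h t = F t"
        using h[of k] by blast
      \<comment> \<open>\<open>F\<close> is integrable on the compact interval
        \<open>{a..b}\<close>, hence on its part in stage \<open>k\<close>, even when that stage is
        unbounded.\<close>
      have "set_integrable lborel (?A k) F"
        by (rule set_integrable_subset[OF borel_integrable_atLeastAtMost' meas])
          (auto intro: continuous_on_subset[OF F(1)])
      then show ?thesis
        by (rule set_integrable_cong[THEN iffD1, rotated -1]) (auto simp: F(2))
    qed
  qed (use meas in auto)
  moreover have "(\<Union>k\<in>{..N}. ?A k) = {a..b}"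
  proof -
    have "t \<in> (\<Union>k\<in>{..N}. ?A k)" if "t \<in> {a..b}" for t
    proof -
      have "0 \<le> t" using that a by simp
      then obtain k where "shock k \<le> ereal t" "ereal t < shock (Suc k)"
        using current_stage by blast
      then show ?thesis using that stage_bound[of k t] by auto
    qed
    then show ?thesis by blast
  qed
  ultimately show ?thesis by simp
qed

section \<open>The law of the flow\<close>

text \<open>The default value makes the flow vanish outside the finite set \<open>sites\<close>, so
  it differs from a constant at finitely many points.\<close>

lemma borel_flow: "(\<lambda>y. flow y t) \<in> borel_measurable borel"
  by (rule measurable_discrete_difference[of "\<lambda>_. 0" _ _ sites])
    (auto simp: flow_def finite_sites countable_finite)

abbreviation flow_law :: "real \<Rightarrow> real measure" where
  "flow_law t \<equiv> distr \<rho>\<^sub>0 borel (\<lambda>y. flow y t)"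

text \<open>Seen as the image of a measure on finitely many indices, the law integrates every real
  Borel function.\<close>

lemma flow_law_eq_point:
  "flow_law t = distr (point_measure {1..N} (\<lambda>j. ennreal (m j))) borel (\<lambda>j. flow (x j) t)"
  unfolding \<rho>\<^sub>0_def using borel_flow by (subst distr_distr) (auto simp: point_measure_def o_def)

lemma integrable_flow_law:
  fixes F :: "real \<Rightarrow> real"
  assumes "F \<in> borel_measurable borel"
  shows "integrable (flow_law t) F"
  unfolding flow_law_eq_point using assms
  by (subst integrable_distr_eq)
    (auto simp: point_measure_def intro!: integrable_point_measure_finite[unfolded point_measure_def])

lemma integral_flow_law:
  fixes F :: "real \<Rightarrow> real"
  assumes "F \<in> borel_measurable borel"
  shows "(LINT y|flow_law t. F y) = (\<Sum>j\<in>{1..N}. m j * F (flow (x j) t))"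
proof -
  have "(LINT y|flow_law t. F y) = (LINT y|\<rho>\<^sub>0. F (flow y t))"
    using assms borel_flow by (intro integral_distr) (auto simp: \<rho>\<^sub>0_def)
  also have "\<dots> = (\<Sum>j\<in>{1..N}. m j * F (flow (x j) t))"
    using measurable_compose[OF borel_flow assms] by (intro integral_\<rho>\<^sub>0)
  finally show ?thesis .
qed

lemma signed_borel_flow_law:
  "w \<in> borel_measurable borel \<Longrightarrow> signed_borel (flow_law t) w"
  using prob_space.prob_space_distr[OF prob_space_\<rho>\<^sub>0, of "\<lambda>y. flow y t" borel] borel_flow
  by (auto simp: signed_borel_def integrable_flow_law prob_space_def measurable_\<rho>\<^sub>0)

section \<open>Weak continuity in time\<close>

text \<open>The field \<open>w\<close> may jump along a trajectory. Once its integrals are rewritten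
  with data \<open>b\<close> continuous in time, only continuous trajectories and continuous
  coefficients remain.\<close>

lemma continuous_on_flow_integral:
  fixes g :: "real \<Rightarrow> real" and b :: "real \<Rightarrow> real \<Rightarrow> real"
  assumes w: "\<And>t. t \<ge> 0 \<Longrightarrow>
      (LINT y|flow_law t. g y * w y t) = (\<Sum>j\<in>{1..N}. m j * (g (flow (x j) t) * b (x j) t))"
    and g: "continuous_on UNIV g"
    and b: "\<And>y. continuous_on {0..} (b y)"
  shows "continuous_on {0..} (\<lambda>t. LINT y|flow_law t. g y * w y t)"
proof -
  have "continuous_on {0..} (\<lambda>t. \<Sum>j\<in>{1..N}. m j * (g (flow (x j) t) * b (x j) t))"
    by (intro continuous_intros b continuous_on_compose2[OF g continuous_on_flow])
      (auto simp: x_in_sites)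
  then show ?thesis by (rule continuous_on_cong[THEN iffD1, rotated -1]) (auto simp: w)
qed

text \<open>Continuity in time gives both one-sided limits at once, and the field at
  \<open>t\<close> itself serves as the left limit.\<close>

lemma cadlag_field_if_continuous:
  assumes w: "\<And>t. t > 0 \<Longrightarrow> (\<lambda>y. w y t) \<in> borel_measurable borel"
    and cont: "\<And>g. continuous_on UNIV g \<Longrightarrow> continuous_on {0..} (\<lambda>t. LINT y|flow_law t. g y * w y t)"
  shows "cadlag_field flow_law w"
proof -
  \<comment> \<open>A general \<open>S\<close> covers \<open>at_right t\<close> and
    \<open>at_left t\<close> together.\<close>
  have "weakly_tends flow_law w (flow_law t) (\<lambda>y. w y t) (at t within S)"
    if "t > 0" for t S
    unfolding weakly_tends_def
  proof (intro allI impI)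
    fix g :: "real \<Rightarrow> real" assume g: "continuous_on UNIV g \<and> bounded (range g)"
    have "continuous_on {0<..} (\<lambda>t. LINT y|flow_law t. g y * w y t)"
      using cont g by (blast intro: continuous_on_subset[of "{0..}"] less_imp_le)
    then have "((\<lambda>s. LINT y|flow_law s. g y * w y s) \<longlongrightarrow> (LINT y|flow_law t. g y * w y t)) (at t)"
      using that by (simp add: continuous_on_eq_continuous_at isCont_def)
    then show "((\<lambda>s. LINT y|flow_law s. g y * w y s) \<longlongrightarrow> (LINT y|flow_law t. g y * w y t)) (at t within S)"
      by (rule tendsto_within_subset) simp
  qed
  then show ?thesis
    unfolding cadlag_field_def using w signed_borel_flow_law by blast
qed

section \<open>Momentum and force integrals of the Eulerian fields\<close>

context
  fixes u \<gamma> :: "real \<Rightarrow> real \<Rightarrow> real"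
  assumes u: "eulerian u velocity" and \<gamma>: "eulerian \<gamma> acceleration"
begin

lemma borel_fields:
  assumes "t \<ge> 0"
  shows "(\<lambda>y. u y t) \<in> borel_measurable borel" "(\<lambda>y. \<gamma> y t) \<in> borel_measurable borel"
  using u \<gamma> assms by (auto simp: eulerian_def)

lemma flow_fields:
  assumes "t \<ge> 0" "j \<in> {1..N}"
  shows "u (flow (x j) t) t = cluster_mean (\<lambda>\<eta>. u\<^sub>0 \<eta> + t * \<gamma>\<^sub>0 \<eta>) (cluster_of (x j) t)"
    "\<gamma> (flow (x j) t) t = cluster_mean \<gamma>\<^sub>0 (cluster_of (x j) t)"
  using u \<gamma> assms
  by (auto simp: eulerian_def x_in_sites velocity_eq_mean[symmetric] acceleration_eq_mean[symmetric])

text \<open>A function of the position is constant on clusters, so \<open>sum_cluster_mean\<close>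
  trades the cluster velocity for the free velocity of each particle. The result is continuous in
  time whenever \<open>F\<close> is.\<close>

lemma integral_momentum:
  assumes t: "t \<ge> 0" and F: "F \<in> borel_measurable borel"
  shows "(LINT y|flow_law t. F y * u y t)
    = (\<Sum>j\<in>{1..N}. m j * (F (flow (x j) t) * (u\<^sub>0 (x j) + t * \<gamma>\<^sub>0 (x j))))"
proof -
  have "(LINT y|flow_law t. F y * u y t)
      = (\<Sum>j\<in>{1..N}. m j * (F (flow (x j) t) * u (flow (x j) t) t))"
    using borel_fields(1)[OF t] F by (intro integral_flow_law) auto
  also have "\<dots> = (\<Sum>j\<in>{1..N}. m j * (F (flow (x j) t) *
      cluster_mean (\<lambda>\<eta>. u\<^sub>0 \<eta> + t * \<gamma>\<^sub>0 \<eta>) (cluster_of (x j) t)))"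
    using t by (simp add: flow_fields)
  also have "\<dots> = (\<Sum>j\<in>{1..N}. m j * (F (flow (x j) t) * (u\<^sub>0 (x j) + t * \<gamma>\<^sub>0 (x j))))"
    by (rule sum_cluster_mean[OF t, of "\<lambda>y. F (flow y t)"]) (simp add: flow_def)
  finally show ?thesis .
qed

lemma integral_force:
  assumes t: "t \<ge> 0" and F: "F \<in> borel_measurable borel"
  shows "(LINT y|flow_law t. F y * \<gamma> y t)
    = (\<Sum>j\<in>{1..N}. m j * (F (flow (x j) t) * \<gamma>\<^sub>0 (x j)))"
proof -
  have "(LINT y|flow_law t. F y * \<gamma> y t)
      = (\<Sum>j\<in>{1..N}. m j * (F (flow (x j) t) * \<gamma> (flow (x j) t) t))"
    using borel_fields(2)[OF t] F by (intro integral_flow_law) auto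
  also have "\<dots> = (\<Sum>j\<in>{1..N}. m j * (F (flow (x j) t) * cluster_mean \<gamma>\<^sub>0 (cluster_of (x j) t)))"
    using t by (simp add: flow_fields)
  also have "\<dots> = (\<Sum>j\<in>{1..N}. m j * (F (flow (x j) t) * \<gamma>\<^sub>0 (x j)))"
    by (rule sum_cluster_mean[OF t, of "\<lambda>y. F (flow y t)"]) (simp add: flow_def)
  finally show ?thesis .
qed

text \<open>Apply \<open>integral_momentum\<close> to \<open>F * u\<close>, again a function of the
  position. Only one factor \<open>u\<close> turns into free data; the other remains the cluster
  velocity, which is what the product rule produces later.\<close>

lemma integral_momentum_flux:
  assumes t: "t \<ge> 0" and F: "F \<in> borel_measurable borel"
  shows "(LINT y|flow_law t. F y * (u y t)\<^sup>2)
    = (\<Sum>j\<in>{1..N}. m j * (F (flow (x j) t) * u (flow (x j) t) t * (u\<^sub>0 (x j) + t * \<gamma>\<^sub>0 (x j))))"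
  using integral_momentum[OF t, of "\<lambda>y. F y * u y t"] borel_fields(1)[OF t] F
  by (simp add: power2_eq_square mult.assoc)

lemma continuous_mass:
  fixes g :: "real \<Rightarrow> real"
  assumes "continuous_on UNIV g"
  shows "continuous_on {0..} (\<lambda>t. LINT y|flow_law t. g y * 1)"
proof (rule continuous_on_flow_integral[where w = "\<lambda>_ _. 1" and b = "\<lambda>_ _. 1"])
  show "(LINT y|flow_law t. g y * 1) = (\<Sum>j\<in>{1..N}. m j * (g (flow (x j) t) * 1))" for t
    using borel_measurable_continuous_onI[OF assms] by (simp add: integral_flow_law)
qed (intro assms continuous_on_const)+

lemma continuous_momentum:
  assumes "continuous_on UNIV g"
  shows "continuous_on {0..} (\<lambda>t. LINT y|flow_law t. g y * u y t)"
proof (rule continuous_on_flow_integral[where b = "\<lambda>y t. u\<^sub>0 y + t * \<gamma>\<^sub>0 y"])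
  show "continuous_on {0..} (\<lambda>t. u\<^sub>0 y + t * \<gamma>\<^sub>0 y)" for y
    by (intro continuous_intros)
qed (rule integral_momentum assms borel_measurable_continuous_onI | assumption)+

lemma continuous_force:
  assumes "continuous_on UNIV g"
  shows "continuous_on {0..} (\<lambda>t. LINT y|flow_law t. g y * \<gamma> y t)"
  by (rule continuous_on_flow_integral[where b = "\<lambda>y t. \<gamma>\<^sub>0 y"])
    (rule integral_force assms borel_measurable_continuous_onI continuous_on_const | assumption)+

lemma set_integrable_momentum_flux:
  assumes a: "0 \<le> a" and D: "continuous_on UNIV D"
  shows "set_integrable lborel {a..b} (\<lambda>t. LINT y|flow_law t. D y * (u y t)\<^sup>2)"
proof (rule set_integrable_stagewise[OF a])
  fix k
  have "\<forall>j\<in>{1..N}. \<exists>G. \<forall>t. shock k \<le> ereal t \<and> ereal t < shock (Suc k) \<longrightarrow>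
      cluster_of (x j) t = G \<and> flow (x j) t = center G t"
  proof
    fix j assume "j \<in> {1..N}"
    then obtain G where
      "\<forall>t. shock k \<le> ereal t \<and> ereal t < shock (Suc k) \<longrightarrow> cluster_of (x j) t = G"
      "\<forall>t. shock k \<le> ereal t \<and> ereal t \<le> shock (Suc k) \<longrightarrow> flow (x j) t = center G t"
      using stage_trajectory[OF x_in_sites, of j k] by blast
    then show "\<exists>G. \<forall>t. shock k \<le> ereal t \<and> ereal t < shock (Suc k) \<longrightarrow>
        cluster_of (x j) t = G \<and> flow (x j) t = center G t"
      by (intro exI[of _ G]) (simp add: less_imp_le)
  qed
  then have "\<exists>G. \<forall>j\<in>{1..N}. \<forall>t. shock k \<le> ereal t \<and> ereal t < shock (Suc k) \<longrightarrow>
      cluster_of (x j) t = G j \<and> flow (x j) t = center (G j) t"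
    by (rule bchoice)
  then obtain G where G: "\<forall>j\<in>{1..N}. \<forall>t. shock k \<le> ereal t \<and> ereal t < shock (Suc k) \<longrightarrow>
      cluster_of (x j) t = G j \<and> flow (x j) t = center (G j) t"
    by (rule exE)
  \<comment> \<open>The clusters of stage \<open>k\<close> are frozen as \<open>G j\<close>, which
    makes \<open>?F\<close> continuous at all times; it represents the flux on stage
    \<open>k\<close>.\<close>
  let ?F = "\<lambda>t. \<Sum>j\<in>{1..N}. m j * (D (center (G j) t) *
    cluster_mean (\<lambda>\<eta>. u\<^sub>0 \<eta> + t * \<gamma>\<^sub>0 \<eta>) (G j) * (u\<^sub>0 (x j) + t * \<gamma>\<^sub>0 (x j)))"
  have "continuous_on UNIV (\<lambda>t. cluster_mean (\<lambda>\<eta>. u\<^sub>0 \<eta> + t * \<gamma>\<^sub>0 \<eta>) H)" for H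
    unfolding cluster_mean_def divide_inverse by (intro continuous_intros)
  then have "continuous_on UNIV ?F"
    by (intro continuous_intros continuous_on_compose2[OF D continuous_on_center]) auto
  moreover have "(LINT y|flow_law t. D y * (u y t)\<^sup>2) = ?F t"
    if t: "shock k \<le> ereal t" "ereal t < shock (Suc k)" for t
  proof -
    have "(LINT y|flow_law t. D y * (u y t)\<^sup>2) = (\<Sum>j\<in>{1..N}. m j * (D (flow (x j) t) *
        u (flow (x j) t) t * (u\<^sub>0 (x j) + t * \<gamma>\<^sub>0 (x j))))"
      using shock_nonneg[OF t(1)] D
      by (intro integral_momentum_flux borel_measurable_continuous_onI)
    also have "\<dots> = ?F t"
    proof (intro sum.cong refl)
      fix j assume j: "j \<in> {1..N}"
      show "m j * (D (flow (x j) t) * u (flow (x j) t) t * (u\<^sub>0 (x j) + t * \<gamma>\<^sub>0 (x j)))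
        = m j * (D (center (G j) t) * cluster_mean (\<lambda>\<eta>. u\<^sub>0 \<eta> + t * \<gamma>\<^sub>0 \<eta>) (G j) *
          (u\<^sub>0 (x j) + t * \<gamma>\<^sub>0 (x j)))"
        unfolding flow_fields(1)[OF shock_nonneg[OF t(1)] j] using G j t by simp
    qed
    finally show ?thesis .
  qed
  ultimately show "\<exists>F. continuous_on UNIV F \<and> (\<forall>t. shock k \<le> ereal t \<longrightarrow>
      ereal t < shock (Suc k) \<longrightarrow> (LINT y|flow_law t. D y * (u y t)\<^sup>2) = F t)"
    by blast
qed

section \<open>The weak formulation\<close>

lemma flow_has_derivative_u:
  assumes "j \<in> {1..N}" "0 \<le> t" "t \<notin> shock_times"
  shows "(flow (x j) has_real_derivative u (flow (x j) t) t) (at t)"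
  using flow_has_derivative[OF x_in_sites[OF assms(1)] assms(2,3)] u assms
  by (simp add: eulerian_def x_in_sites)

lemma weak_solution_flow_law: "weak_solution flow_law u \<gamma> \<rho>\<^sub>0 u\<^sub>0 \<gamma>\<^sub>0"
proof -
  have cadlag: "cadlag_field flow_law (\<lambda>y t. 1)" "cadlag_field flow_law u" "cadlag_field flow_law \<gamma>"
    by (rule cadlag_field_if_continuous; rule continuous_mass continuous_momentum continuous_force
        borel_fields borel_measurable_const; simp)+
  have initial: "((\<lambda>t. LINT y|flow_law t. g y) \<longlongrightarrow> (LINT y|\<rho>\<^sub>0. g y)) (at_right 0) \<and>
      ((\<lambda>t. LINT y|flow_law t. g y * u y t) \<longlongrightarrow> (LINT y|\<rho>\<^sub>0. g y * u\<^sub>0 y)) (at_right 0) \<and>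
      ((\<lambda>t. LINT y|flow_law t. g y * \<gamma> y t) \<longlongrightarrow> (LINT y|\<rho>\<^sub>0. g y * \<gamma>\<^sub>0 y)) (at_right 0)"
    if g: "continuous_on UNIV g" for g
  proof -
    have gm: "g \<in> borel_measurable borel" using g by (rule borel_measurable_continuous_onI)
    \<comment> \<open>Continuity on the half-line includes time 0, so the initial limits are simply
      the values at 0, where the flow is the identity on \<open>sites\<close>.\<close>
    have lim: "(F \<longlongrightarrow> F 0) (at_right 0)" if "continuous_on {0..} F" for F :: "real \<Rightarrow> real"
      using that by (auto simp: continuous_on_def intro: tendsto_within_subset)
    have "(LINT y|flow_law 0. g y * 1) = (LINT y|\<rho>\<^sub>0. g y)"
      using gm by (simp add: integral_flow_law integral_\<rho>\<^sub>0 flow_initial x_in_sites)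
    moreover have "(LINT y|flow_law 0. g y * u y 0) = (LINT y|\<rho>\<^sub>0. g y * u\<^sub>0 y)"
      using gm u0_borel by (simp add: integral_momentum integral_\<rho>\<^sub>0 flow_initial x_in_sites)
    moreover have "(LINT y|flow_law 0. g y * \<gamma> y 0) = (LINT y|\<rho>\<^sub>0. g y * \<gamma>\<^sub>0 y)"
      using gm \<gamma>0_borel by (simp add: integral_force integral_\<rho>\<^sub>0 flow_initial x_in_sites)
    ultimately show ?thesis
      using lim[OF continuous_mass[OF g]] lim[OF continuous_momentum[OF g]]
        lim[OF continuous_force[OF g]] by simp
  qed
  have balance: "(\<forall>t\<in>{a..b}. integrable (flow_law t) (\<lambda>y. deriv f y * (u y t)\<^sup>2)) \<and>
      set_integrable lborel {a..b} (\<lambda>t. LINT y|flow_law t. deriv f y * u y t) \<and>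
      set_integrable lborel {a..b} (\<lambda>t. LINT y|flow_law t. deriv f y * (u y t)\<^sup>2) \<and>
      set_integrable lborel {a..b} (\<lambda>t. LINT y|flow_law t. f y * \<gamma> y t) \<and>
      (LINT y|flow_law b. f y) - (LINT y|flow_law a. f y)
        = (LINT t:{a..b}|lborel. LINT y|flow_law t. deriv f y * u y t) \<and>
      (LINT y|flow_law b. f y * u y b) - (LINT y|flow_law a. f y * u y a)
        = (LINT t:{a..b}|lborel. LINT y|flow_law t. deriv f y * (u y t)\<^sup>2)
          + (LINT t:{a..b}|lborel. LINT y|flow_law t. f y * \<gamma> y t)"
    if f: "f C1_differentiable_on UNIV" and ab: "0 < a" "a < b" for f a b
  proof (intro conjI)
    obtain D where D: "\<And>y. (f has_real_derivative D y) (at y)" "continuous_on UNIV D"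
      using f by (auto simp: C1_differentiable_on_def has_real_derivative_iff_has_vector_derivative)
    have df: "deriv f = D" using D(1) by (auto intro: DERIV_imp_deriv)
    have cf: "continuous_on UNIV f"
      using D(1) DERIV_isCont by (intro continuous_at_imp_continuous_on) blast
    have meas: "f \<in> borel_measurable borel" "D \<in> borel_measurable borel"
      using cf D(2) borel_measurable_continuous_onI by auto
    have sub: "{a..b} \<subseteq> {0..}" using ab by auto
    show "\<forall>t\<in>{a..b}. integrable (flow_law t) (\<lambda>y. deriv f y * (u y t)\<^sup>2)"
      unfolding df using ab meas borel_fields
      by (auto intro!: integrable_flow_law borel_measurable_times borel_measurable_power)
    show 1: "set_integrable lborel {a..b} (\<lambda>t. LINT y|flow_law t. deriv f y * u y t)"
      unfolding df using continuous_momentum[OF D(2)] sub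
      by (blast intro: borel_integrable_atLeastAtMost' continuous_on_subset)
    show 2: "set_integrable lborel {a..b} (\<lambda>t. LINT y|flow_law t. deriv f y * (u y t)\<^sup>2)"
      unfolding df using D(2) ab by (intro set_integrable_momentum_flux) auto
    show 3: "set_integrable lborel {a..b} (\<lambda>t. LINT y|flow_law t. f y * \<gamma> y t)"
      using continuous_force[OF cf] sub
      by (blast intro: borel_integrable_atLeastAtMost' continuous_on_subset)
    have dflow: "((\<lambda>t. f (flow (x j) t)) has_real_derivative
        D (flow (x j) t) * u (flow (x j) t) t) (at t)"
      if "j \<in> {1..N}" "0 \<le> t" "t \<notin> shock_times" for j t
      using DERIV_chain2[OF D(1) flow_has_derivative_u[OF that]] .
    have cflow: "continuous_on {a..b} (\<lambda>t. f (flow (x j) t))" if "j \<in> {1..N}" for j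
      using continuous_on_subset[OF continuous_on_flow[OF x_in_sites[OF that]] sub]
      by (intro continuous_on_compose2[OF cf]) auto
    \<comment> \<open>The integral of \<open>f\<close> against the law, as a sum over particles. The
      chain rule along each trajectory gives the integral of \<open>deriv f * u\<close> as its
      derivative off the shocks.\<close>
    let ?M = "\<lambda>t. \<Sum>j\<in>{1..N}. m j * f (flow (x j) t)"
    have "(LINT t:{a..b}|lborel. LINT y|flow_law t. deriv f y * u y t) = ?M b - ?M a"
    proof (rule set_integral_FTC_finite_exceptions[OF finite_shock_times _ _ _ 1])
      show "continuous_on {a..b} ?M" by (intro continuous_intros cflow)
      fix t assume "t \<in> {a<..<b} - shock_times"
      then have t: "0 \<le> t" "t \<notin> shock_times" using ab by auto
      have "(LINT y|flow_law t. deriv f y * u y t)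
          = (\<Sum>j\<in>{1..N}. m j * (D (flow (x j) t) * u (flow (x j) t) t))"
        unfolding df using meas borel_fields[OF t(1)] by (intro integral_flow_law) auto
      then show "(?M has_real_derivative (LINT y|flow_law t. deriv f y * u y t)) (at t)"
        using dflow t by (auto intro!: DERIV_sum DERIV_cmult)
    qed (use ab in simp)
    then show "(LINT y|flow_law b. f y) - (LINT y|flow_law a. f y)
        = (LINT t:{a..b}|lborel. LINT y|flow_law t. deriv f y * u y t)"
      using meas by (simp add: integral_flow_law)
    \<comment> \<open>The momentum tested against \<open>f\<close>, written with free velocities so
      that it is continuous across shocks and each summand can be differentiated by the product
      rule.\<close>
    let ?Q = "\<lambda>t. \<Sum>j\<in>{1..N}. m j * (f (flow (x j) t) * (u\<^sub>0 (x j) + t * \<gamma>\<^sub>0 (x j)))"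
    have "(LINT t:{a..b}|lborel. (LINT y|flow_law t. deriv f y * (u y t)\<^sup>2)
        + (LINT y|flow_law t. f y * \<gamma> y t)) = ?Q b - ?Q a"
    proof (rule set_integral_FTC_finite_exceptions[OF finite_shock_times _ _ _ set_integral_add(1)[OF 2 3]])
      show "continuous_on {a..b} ?Q" by (intro continuous_intros cflow)
      fix t assume "t \<in> {a<..<b} - shock_times"
      then have t: "0 \<le> t" "t \<notin> shock_times" using ab by auto
      \<comment> \<open>The two terms of the product rule are the summands of
        \<open>integral_momentum_flux\<close> and \<open>integral_force\<close>, arranged in the
        shape that \<open>DERIV_mult\<close> yields.\<close>
      have "(LINT y|flow_law t. deriv f y * (u y t)\<^sup>2) + (LINT y|flow_law t. f y * \<gamma> y t)
          = (\<Sum>j\<in>{1..N}. m j * (D (flow (x j) t) * u (flow (x j) t) t * (u\<^sub>0 (x j) + t * \<gamma>\<^sub>0 (x j))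
            + \<gamma>\<^sub>0 (x j) * f (flow (x j) t)))"
        unfolding df integral_momentum_flux[OF t(1) meas(2)] integral_force[OF t(1) meas(1)]
        by (simp add: sum.distrib[symmetric] algebra_simps)
      moreover have "((\<lambda>t. u\<^sub>0 (x j) + t * \<gamma>\<^sub>0 (x j)) has_real_derivative \<gamma>\<^sub>0 (x j)) (at t)" for j
        by (auto intro!: derivative_eq_intros)
      ultimately show "(?Q has_real_derivative (LINT y|flow_law t. deriv f y * (u y t)\<^sup>2)
          + (LINT y|flow_law t. f y * \<gamma> y t)) (at t)"
        using dflow t by (auto intro!: DERIV_sum DERIV_cmult DERIV_mult)
    qed (use ab in simp)
    then show "(LINT y|flow_law b. f y * u y b) - (LINT y|flow_law a. f y * u y a)
        = (LINT t:{a..b}|lborel. LINT y|flow_law t. deriv f y * (u y t)\<^sup>2)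
          + (LINT t:{a..b}|lborel. LINT y|flow_law t. f y * \<gamma> y t)"
      using meas ab set_integral_add(2)[OF 2 3] by (simp add: integral_momentum)
  qed
  show ?thesis
    unfolding weak_solution_def using cadlag initial balance by blast
qed

end

end

theorem theorem5p3:
  fixes N :: nat and x m :: "nat \<Rightarrow> real" and u\<^sub>0 \<gamma>\<^sub>0 :: "real \<Rightarrow> real"
    and u \<gamma> :: "real \<Rightarrow> real \<Rightarrow> real"
    and P :: "'a measure" and X\<^sub>0 :: "'a \<Rightarrow> real"
  assumes particles: "sticky_particles N x m u\<^sub>0 \<gamma>\<^sub>0"
    and nonincreasing: "antimono_on (sticky_particles.sites N x) \<gamma>\<^sub>0"
    and u: "sticky_particles.eulerian N x m u\<^sub>0 \<gamma>\<^sub>0 u (sticky_particles.velocity N x m u\<^sub>0 \<gamma>\<^sub>0)"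
    and \<gamma>: "sticky_particles.eulerian N x m u\<^sub>0 \<gamma>\<^sub>0 \<gamma> (sticky_particles.acceleration N x m u\<^sub>0 \<gamma>\<^sub>0)"
    and P: "prob_space P"
    and X0: "X\<^sub>0 \<in> borel_measurable P"
    and law: "distr P borel X\<^sub>0 = sticky_particles.\<rho>\<^sub>0 N x m"
  shows "weak_solution
           (\<lambda>t. distr P borel (\<lambda>\<omega>. sticky_particles.flow N x m u\<^sub>0 \<gamma>\<^sub>0 (X\<^sub>0 \<omega>) t))
           u \<gamma> (sticky_particles.\<rho>\<^sub>0 N x m) u\<^sub>0 \<gamma>\<^sub>0"
proof -
  interpret sticky_particles N x m u\<^sub>0 \<gamma>\<^sub>0 by (rule particles)
  \<comment> \<open>The law of the flow started from \<open>X\<^sub>0\<close> depends on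
    \<open>X\<^sub>0\<close> only through its law, so it is the image of
    \<open>\<rho>\<^sub>0\<close> under the flow.\<close>
  have "distr P borel (\<lambda>\<omega>. flow (X\<^sub>0 \<omega>) t) = flow_law t" for t
    using distr_distr[OF borel_flow X0, of t] by (simp add: law o_def)
  then show ?thesis using weak_solution_flow_law[OF u \<gamma>] by simp
qed

end
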